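(* Let $S$ be a semigroup and let $\sigma:S\to S$ be an automorphism (not necessarily involutive). The solutions $f,g:S\to\mathbb{C}$ of the functional equation $$f(x\sigma(y))=f(x)g(y)-f(y)g(x),\quad x,y\in S,$$ are exactly the following pairs: (1) $f=0$ and $g$ is arbitrary. (2) $f$ is any non-zero function such that $f=0$ on $S^2$ and $g=\alpha f$, where $\alpha\in\mathbb{C}$. (3) $f=c(\chi-\chi^* )$ and $g=\dfrac{\chi+\chi^*}{2}+c_1\dfrac{\chi-\chi^*}{2}$, where $\chi:S\to\mathbb{C}$ is a multiplicative function such that $\chi\neq\chi^*$, $\chi\circ\sigma^2=\chi$, $c_1\in\mathbb{C}$ and $c\in\mathbb{C}\setminus\{0\}$. (4) $f=\phi_\chi$ and $g=\chi+c_2\phi_\chi$, where $\chi:S\to\mathbb{C}$ is a non-zero multiplicative function and $\phi_\chi:S\to\mathbb{C}$ satisfies $\phi_\chi(xy)=\phi_\chi(x)\chi(y)+\phi_\chi(y)\chi(x)$ for all $x,y\in S$, such that $\chi^*=\chi$, $\phi_\chi^*=-\phi_\chi$, and $c_2\in\mathbb{C}$ is a constant. Moreover, off the exceptional case (1), $f$ and $g$ are abelian. Furthermore, off the exceptional case (1), if $S$ is a topological semigroup and $f\in C(S)$, then $g,\chi,\chi^*,\phi_\chi\in C(S)$ (for those of these functions that occur in the respective case).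
   Context: A semigroup is a set with an associative binary operation. An automorphism $\sigma:S\to S$ is a bijection with $\sigma(xy)=\sigma(x)\sigma(y)$ for all $x,y\in S$. A function $\mu:S\to\mathbb{C}$ is multiplicative if $\mu(xy)=\mu(x)\mu(y)$ for all $x,y\in S$ (the zero function is allowed). For $f:S\to\mathbb{C}$, put $f^*:=f\circ\sigma$. $S^2:=\{xy\mid x,y\in S\}$. A function $f:S\to\mathbb{C}$ is central if $f(xy)=f(yx)$ for all $x,y\in S$, and abelian if it is central and $f(xyz)=f(xzy)$ for all $x,y,z\in S$. A topological semigroup is a semigroup with a topology such that the product $(x,y)\mapsto xy$ is continuous from $S\times S$ (product topology) to $S$; then $C(S)$ denotes the set of continuous functions $S\to\mathbb{C}$. (The automorphism $\sigma$ is not assumed continuous.) The exceptional case (1) is the case $f=0$. *)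

theory Defs
  imports "HOL-Analysis.Analysis"
begin

definition semigroup_automorphism :: "('a::semigroup_mult \<Rightarrow> 'a) \<Rightarrow> bool" where
  "semigroup_automorphism \<sigma> \<longleftrightarrow> bij \<sigma> \<and> (\<forall>x y. \<sigma> (x * y) = \<sigma> x * \<sigma> y)"

text \<open>The zero function counts as multiplicative.\<close>

definition multiplicative_fun :: "('a::semigroup_mult \<Rightarrow> complex) \<Rightarrow> bool" where
  "multiplicative_fun \<mu> \<longleftrightarrow> (\<forall>x y. \<mu> (x * y) = \<mu> x * \<mu> y)"

definition star :: "('a \<Rightarrow> 'a) \<Rightarrow> ('a \<Rightarrow> complex) \<Rightarrow> 'a \<Rightarrow> complex" where
  "star \<sigma> f = f \<circ> \<sigma>"

definition products :: "'a::semigroup_mult set" where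
  "products = {x * y | x y. True}"

definition central_fun :: "('a::semigroup_mult \<Rightarrow> complex) \<Rightarrow> bool" where
  "central_fun f \<longleftrightarrow> (\<forall>x y. f (x * y) = f (y * x))"

definition abelian_fun :: "('a::semigroup_mult \<Rightarrow> complex) \<Rightarrow> bool" where
  "abelian_fun f \<longleftrightarrow> central_fun f \<and> (\<forall>x y z. f (x * y * z) = f (x * z * y))"

text \<open>The topology is an explicit object rather than a class instance, so that one theorem can
  speak about a bare semigroup and, in addition, about all semigroup topologies on it.
  No separation axiom is imposed.\<close>

definition topological_semigroup :: "'a::semigroup_mult topology \<Rightarrow> bool" where
  "topological_semigroup T \<longleftrightarrow>
     topspace T = UNIV \<and> continuous_map (prod_topology T T) T (\<lambda>(x, y). x * y)"

definition continuous_functions :: "'a topology \<Rightarrow> ('a \<Rightarrow> complex) set" where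
  "continuous_functions T = {f. continuous_map T euclidean f}"

definition sine_subtraction_solution ::
    "('a::semigroup_mult \<Rightarrow> 'a) \<Rightarrow> ('a \<Rightarrow> complex) \<Rightarrow> ('a \<Rightarrow> complex) \<Rightarrow> bool" where
  "sine_subtraction_solution \<sigma> f g \<longleftrightarrow> (\<forall>x y. f (x * \<sigma> y) = f x * g y - f y * g x)"

text \<open>The families of solutions other than the exceptional one \<open>f = 0\<close>. The
  parameters are arguments of the predicates because the continuity statement refers to them.
  In the last family \<open>\<phi> = 0\<close> is not excluded; it yields solutions with \<open>f = 0\<close>.\<close>

definition null_on_products_form ::
    "('a::semigroup_mult \<Rightarrow> complex) \<Rightarrow> ('a \<Rightarrow> complex) \<Rightarrow> complex \<Rightarrow> bool" where
  "null_on_products_form f g \<alpha> \<longleftrightarrow>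
     f \<noteq> (\<lambda>_. 0) \<and> (\<forall>z\<in>products. f z = 0) \<and> g = (\<lambda>x. \<alpha> * f x)"

definition character_pair_form ::
    "('a::semigroup_mult \<Rightarrow> 'a) \<Rightarrow> ('a \<Rightarrow> complex) \<Rightarrow> ('a \<Rightarrow> complex)
      \<Rightarrow> ('a \<Rightarrow> complex) \<Rightarrow> complex \<Rightarrow> complex \<Rightarrow> bool" where
  "character_pair_form \<sigma> f g chi c c1 \<longleftrightarrow>
     multiplicative_fun chi \<and> chi \<noteq> star \<sigma> chi \<and> chi \<circ> (\<sigma> \<circ> \<sigma>) = chi \<and> c \<noteq> 0 \<and>
     f = (\<lambda>x. c * (chi x - star \<sigma> chi x)) \<and>
     g = (\<lambda>x. (chi x + star \<sigma> chi x) / 2 + c1 * ((chi x - star \<sigma> chi x) / 2))"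

definition sine_addition_form ::
    "('a::semigroup_mult \<Rightarrow> 'a) \<Rightarrow> ('a \<Rightarrow> complex) \<Rightarrow> ('a \<Rightarrow> complex)
      \<Rightarrow> ('a \<Rightarrow> complex) \<Rightarrow> ('a \<Rightarrow> complex) \<Rightarrow> complex \<Rightarrow> bool" where
  "sine_addition_form \<sigma> f g chi \<phi> c2 \<longleftrightarrow>
     multiplicative_fun chi \<and> chi \<noteq> (\<lambda>_. 0) \<and>
     (\<forall>x y. \<phi> (x * y) = \<phi> x * chi y + \<phi> y * chi x) \<and>
     star \<sigma> chi = chi \<and> star \<sigma> \<phi> = (\<lambda>x. - \<phi> x) \<and>
     f = \<phi> \<and> g = (\<lambda>x. chi x + c2 * \<phi> x)"

end

theory Submission imports Defs begin

text \<open>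
  Let \<open>f \<noteq> 0\<close> and \<open>f (x * \<sigma> y) = f x * g y - f y * g x\<close>. If \<open>g\<close> is a multiple of \<open>f\<close>, the right-hand
  side vanishes, and surjectivity of \<open>\<sigma>\<close> makes \<open>f\<close> vanish on all products. Otherwise \<open>f\<close> and \<open>g\<close> are
  linearly independent, so coefficients of \<open>f\<close> and \<open>g\<close> may be compared in every identity. Evaluating
  \<open>f\<close> at \<open>x * \<sigma> y * \<sigma> z\<close> in two ways and comparing coefficients expresses \<open>f (y * z)\<close> and
  \<open>g (y * z)\<close> without \<open>\<sigma>\<close>. Feeding these formulas back into the equation, and into associativity,
  forces \<open>star \<sigma> f = - f\<close> and, for \<open>h = g + l f\<close> with a suitable constant \<open>l\<close>, the system
  \<open>f (x * y) = f x * h y + f y * h x\<close>, \<open>h (x * y) = h x * h y + k * f x * f y\<close>, \<open>star \<sigma> h = h\<close>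
  (lemma \<open>independent_solution_addition_laws\<close>).

  This is the system of the sine and cosine addition laws, with a constant in front of the product
  of sines: if \<open>d\<^sup>2 = k\<close>, then \<open>h + d f\<close> and \<open>h - d f\<close> are multiplicative and \<open>\<sigma>\<close> interchanges
  them. For \<open>d \<noteq> 0\<close> they form the pair of characters \<open>chi\<close>, \<open>star \<sigma> chi\<close>; for \<open>d = 0\<close> they coincide
  with \<open>h\<close>, and \<open>f\<close> satisfies the sine addition law with respect to \<open>h\<close> (lemma
  \<open>addition_laws_imp_forms\<close>). Since the system is symmetric in \<open>x\<close> and \<open>y\<close>, both \<open>f\<close> and \<open>g\<close>
  are abelian.

  For continuity, fix \<open>y\<close> with \<open>f y \<noteq> 0\<close> and solve the equation for \<open>g x\<close>: only \<open>f\<close> and right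
  translation by the fixed element \<open>\<sigma> y\<close> occur, and both are continuous. The functions \<open>chi\<close>
  and \<open>star \<sigma> chi\<close> are linear combinations of \<open>f\<close> and \<open>g\<close>.
\<close>

section \<open>Linearly independent solutions\<close>

lemma coefficients_eq_if_not_multiple:
  fixes f g :: "'a \<Rightarrow> complex"
  assumes f0: "f \<noteq> (\<lambda>_. 0)" and ng: "\<And>\<alpha>. g \<noteq> (\<lambda>x. \<alpha> * f x)"
    and eq: "\<And>x. f x * u + g x * v = f x * u' + g x * v'"
  shows "u = u'" and "v = v'"
proof -
  show v: "v = v'"
  proof (rule ccontr)
    assume "v \<noteq> v'"
    then have "g x = (u' - u) / (v - v') * f x" for x
      using eq[of x] by (simp add: field_simps)
    then show False using ng by blast
  qed
  obtain x where "f x \<noteq> 0" using f0 by auto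
  then show "u = u'" using eq[of x] v by simp
qed

text \<open>The two expansions of \<open>f\<close> at \<open>x * \<sigma> y * \<sigma> z = x * \<sigma> (y * z)\<close> express \<open>g (x * \<sigma> y)\<close> linearly in
  \<open>f x\<close> and \<open>g x\<close>, with coefficients that depend on \<open>y\<close> only: this is seen at a single \<open>z\<close> with
  \<open>f z \<noteq> 0\<close>. For arbitrary \<open>z\<close>, comparing coefficients then yields the laws for \<open>f (y * z)\<close> and
  \<open>g (y * z)\<close>, from which \<open>\<sigma>\<close> has disappeared.\<close>

lemma product_laws_without_automorphism:
  fixes f g :: "'a::semigroup_mult \<Rightarrow> complex"
  assumes hom: "\<And>x y. \<sigma> (x * y) = \<sigma> x * \<sigma> y"
    and sol: "\<And>x y. f (x * \<sigma> y) = f x * g y - f y * g x"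
    and f0: "f \<noteq> (\<lambda>_. 0)" and ng: "\<And>\<alpha>. g \<noteq> (\<lambda>x. \<alpha> * f x)"
  obtains A B where
    "\<And>x y. g (x * \<sigma> y) = f x * A y + g x * B y"
    "\<And>y z. f (y * z) = f y * g z + f z * B y"
    "\<And>y z. g (y * z) = g y * g z - f z * A y"
proof -
  have assoc: "f z * g (x * \<sigma> y)
      = f x * (g y * g z - g (y * z)) + g x * (f (y * z) - f y * g z)" for x y z
  proof -
    have "f (x * \<sigma> y * \<sigma> z) = f (x * \<sigma> (y * z))" by (simp add: hom mult.assoc)
    then have "f (x * \<sigma> y) * g z - f z * g (x * \<sigma> y) = f x * g (y * z) - f (y * z) * g x"
      by (simp only: sol)
    then show ?thesis by (simp add: sol algebra_simps)
  qed
  obtain z0 where z0: "f z0 \<noteq> 0" using f0 by auto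
  define A where "A y = (g y * g z0 - g (y * z0)) / f z0" for y
  define B where "B y = (f (y * z0) - f y * g z0) / f z0" for y
  have gs: "g (x * \<sigma> y) = f x * A y + g x * B y" for x y
  proof -
    have "g (x * \<sigma> y) = (f x * (g y * g z0 - g (y * z0)) + g x * (f (y * z0) - f y * g z0)) / f z0"
      unfolding assoc[symmetric] using z0 by simp
    then show ?thesis by (simp add: A_def B_def add_divide_distrib)
  qed
  have cmp: "f x * (f z * A y) + g x * (f z * B y)
      = f x * (g y * g z - g (y * z)) + g x * (f (y * z) - f y * g z)" for x y z
    using assoc[of z x y] by (simp add: gs algebra_simps)
  have "f z * A y = g y * g z - g (y * z)" "f z * B y = f (y * z) - f y * g z" for y z
    using coefficients_eq_if_not_multiple[OF f0 ng, OF cmp[of _ z y]] by auto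
  then have "f (y * z) = f y * g z + f z * B y" "g (y * z) = g y * g z - f z * A y" for y z
    by (simp_all add: algebra_simps)
  then show ?thesis using that gs by blast
qed

text \<open>The unknown coefficients \<open>A\<close> and \<open>B\<close> of the product laws are themselves combinations of \<open>f\<close>
  and \<open>g\<close>, so only four constants have to be found: \<open>A = p f + q g\<close> and \<open>B = a f + b g\<close>. The
  decisive value is \<open>b = 1\<close>: the equation alone gives only \<open>star \<sigma> f = - f / b\<close> and a law for
  \<open>f (y * z)\<close> with weights \<open>1\<close> and \<open>b\<close>, and \<open>b = 1\<close> makes that law symmetric. Since \<open>\<sigma>\<close> then maps
  \<open>g\<close> to \<open>g + a f\<close> and \<open>f\<close> to \<open>- f\<close>, the combination fixed by \<open>\<sigma>\<close> is \<open>h = g + (a / 2) f\<close>.\<close>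

lemma independent_solution_addition_laws:
  fixes f g :: "'a::semigroup_mult \<Rightarrow> complex"
  assumes aut: "semigroup_automorphism \<sigma>"
    and sol: "\<And>x y. f (x * \<sigma> y) = f x * g y - f y * g x"
    and f0: "f \<noteq> (\<lambda>_. 0)" and ng: "\<And>\<alpha>. g \<noteq> (\<lambda>x. \<alpha> * f x)"
  obtains h k l where
    "\<And>x y. f (x * y) = f x * h y + f y * h x"
    "\<And>x y. h (x * y) = h x * h y + k * f x * f y"
    "\<And>x. f (\<sigma> x) = - f x" "\<And>x. h (\<sigma> x) = h x"
    "\<And>x. g x = h x - l * f x"
proof -
  note coeffs = coefficients_eq_if_not_multiple[OF f0 ng]
  have hom: "\<sigma> (x * y) = \<sigma> x * \<sigma> y" for x y
    using aut unfolding semigroup_automorphism_def by blast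
  have surj: "surj \<sigma>" using aut unfolding semigroup_automorphism_def bij_def by blast
  obtain A B where gs: "\<And>x y. g (x * \<sigma> y) = f x * A y + g x * B y"
    and fm: "\<And>y z. f (y * z) = f y * g z + f z * B y"
    and gm: "\<And>y z. g (y * z) = g y * g z - f z * A y"
    using product_laws_without_automorphism[OF hom sol f0 ng] by blast
  obtain z0 where z0: "f z0 \<noteq> 0" using f0 by auto
  \<comment> \<open>Two expressions for \<open>f (y * \<sigma> z)\<close> make \<open>B\<close> a linear combination of \<open>f\<close> and \<open>g\<close>.\<close>
  have fsB: "f (\<sigma> z) * B y = f y * (g z - g (\<sigma> z)) - f z * g y" for y z
    using fm[of y "\<sigma> z"] sol[of y z] by (simp add: algebra_simps)
  obtain z1 where z1: "f (\<sigma> z1) \<noteq> 0" using surjD[OF surj, of z0] z0 by auto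
  define a where "a = (g z1 - g (\<sigma> z1)) / f (\<sigma> z1)"
  define b where "b = - f z1 / f (\<sigma> z1)"
  have B: "B y = a * f y + b * g y" for y
  proof -
    have "B y = (f y * (g z1 - g (\<sigma> z1)) - f z1 * g y) / f (\<sigma> z1)"
      unfolding fsB[symmetric] using z1 by simp
    then show ?thesis by (simp add: a_def b_def diff_divide_distrib right_diff_distrib mult.commute)
  qed
  have cmp: "f y * (f (\<sigma> z) * a) + g y * (f (\<sigma> z) * b)
      = f y * (g z - g (\<sigma> z)) + g y * (- f z)" for y z
    using fsB[of z y] by (simp add: B algebra_simps)
  have fs: "f (\<sigma> z) * b = - f z" and gsig: "f (\<sigma> z) * a = g z - g (\<sigma> z)" for z
    using coeffs[OF cmp[of _ z]] by auto
  have b0: "b \<noteq> 0" using fs[of z0] z0 by auto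
  \<comment> \<open>Associativity of \<open>f (x * y * z0)\<close> yields a law for \<open>B (x * y)\<close>; computing \<open>B (x * y)\<close> from
    \<open>B = a f + b g\<close> instead makes \<open>A\<close> a linear combination of \<open>f\<close> and \<open>g\<close> too.\<close>
  have Bm: "B (x * y) = B x * B y - f x * A y" for x y
  proof -
    have "f (x * y * z0) = f (x * (y * z0))" by (simp add: mult.assoc)
    then have "f (x * y) * g z0 + f z0 * B (x * y) = f x * g (y * z0) + f (y * z0) * B x"
      by (simp only: fm[of "x * y" z0] fm[of x "y * z0"])
    then have "f z0 * B (x * y) = f z0 * (B x * B y - f x * A y)"
      by (simp add: fm[of x y] fm[of y z0] gm[of y z0] algebra_simps)
    then show ?thesis using z0 by simp
  qed
  have lin: "B x * (g y - B y) = f y * (b * A x - a * B x) - f x * A y" for x y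
    using Bm[of x y] unfolding B[of "x * y"] fm gm by (simp add: B algebra_simps)
  define r where "r = g z0 - B z0 + a * f z0"
  define p where "p = (A z0 + a * r) / (b * f z0)"
  define q where "q = r / f z0"
  have p: "b * f z0 * p = A z0 + a * r" and q: "f z0 * q = r"
    using z0 b0 by (simp_all add: p_def q_def)
  have A: "A x = p * f x + q * g x" for x
  proof -
    have "b * f z0 * A x = (a * f x + b * g x) * r + f x * A z0"
      using lin[of x z0] unfolding r_def B[of x, symmetric] by (simp add: algebra_simps)
    also have "\<dots> = f x * (A z0 + a * r) + b * g x * r" by (simp add: algebra_simps)
    also have "\<dots> = f x * (b * f z0 * p) + b * g x * (f z0 * q)" by (simp only: p q)
    also have "\<dots> = b * f z0 * (p * f x + q * g x)" by (simp add: algebra_simps)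
    finally show ?thesis using z0 b0 by simp
  qed
  \<comment> \<open>Two expressions for \<open>g (x * \<sigma> y)\<close>, compared in \<open>x\<close> and then in \<open>y\<close>; the factor \<open>b\<close> clears
    the denominator of \<open>f (\<sigma> y) = - f y / b\<close>.\<close>
  have sig: "f x * (b * A y) + g x * (b * B y)
      = f x * (p * f y) + g x * (b * g y + (a + q) * f y)" for x y
  proof -
    have "f x * A y + g x * B y = g x * g (\<sigma> y) - f (\<sigma> y) * A x"
      using gs[of x y] gm[of x "\<sigma> y"] by simp
    moreover have "g (\<sigma> y) = g y - f (\<sigma> y) * a" using gsig[of y] by simp
    ultimately have "b * (f x * A y + g x * B y)
        = b * (g x * (g y - f (\<sigma> y) * a) - f (\<sigma> y) * A x)" by simp
    also have "\<dots> = g x * (b * g y - (f (\<sigma> y) * b) * a) - (f (\<sigma> y) * b) * A x"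
      by (simp add: algebra_simps)
    finally have "b * (f x * A y + g x * B y)
        = g x * (b * g y - (f (\<sigma> y) * b) * a) - (f (\<sigma> y) * b) * A x" .
    then show ?thesis unfolding fs A[of x] by (simp add: algebra_simps)
  qed
  have "b * A y = p * f y" and "b * B y = b * g y + (a + q) * f y" for y
    using coeffs[OF sig[of _ y]] by auto
  then have "f y * (b * p) + g y * (b * q) = f y * p + g y * 0"
    and "f y * (b * a) + g y * (b * b) = f y * (a + q) + g y * b" for y
    by (simp_all add: A B algebra_simps)
  then have "b * q = 0" "b * b = b" using coeffs(2) by blast+
  then have b1: "b = 1" and q0: "q = 0" using b0 by auto
  define h where "h x = g x + a / 2 * f x" for x
  have neg: "f (\<sigma> x) = - f x" for x using fs[of x] b1 by simp
  have "g (\<sigma> x) = g x + a * f x" for x using gsig[of x] by (simp add: neg algebra_simps)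
  then have "h (\<sigma> x) = h x" for x by (simp add: h_def neg field_simps)
  moreover have "f (x * y) = f x * h y + f y * h x" for x y
    unfolding fm h_def B b1 by (simp add: field_simps)
  moreover have "h (x * y) = h x * h y + (a\<^sup>2 / 4 - p) * f x * f y" for x y
    unfolding h_def fm gm B A b1 q0 by (simp add: field_simps power2_eq_square)
  moreover have "g x = h x - a / 2 * f x" for x by (simp add: h_def)
  ultimately show ?thesis using that neg by blast
qed

section \<open>Classification and abelianness\<close>

lemma null_on_products_form_solves:
  assumes "null_on_products_form f g \<alpha>"
  shows "sine_subtraction_solution \<sigma> f g"
  using assms unfolding null_on_products_form_def sine_subtraction_solution_def products_def
  by auto

lemma character_pair_form_solves:
  assumes "semigroup_automorphism \<sigma>" and "character_pair_form \<sigma> f g chi c c1"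
  shows "sine_subtraction_solution \<sigma> f g"
proof -
  have mult: "chi (x * y) = chi x * chi y" for x y
    using assms(2) unfolding character_pair_form_def multiplicative_fun_def by blast
  have hom: "\<sigma> (x * y) = \<sigma> x * \<sigma> y" for x y
    using assms(1) unfolding semigroup_automorphism_def by blast
  have "chi \<circ> (\<sigma> \<circ> \<sigma>) = chi" using assms(2) unfolding character_pair_form_def by blast
  then have per: "chi (\<sigma> (\<sigma> x)) = chi x" for x by (simp add: fun_eq_iff)
  have f: "f = (\<lambda>x. c * (chi x - chi (\<sigma> x)))"
    and g: "g = (\<lambda>x. (chi x + chi (\<sigma> x)) / 2 + c1 * ((chi x - chi (\<sigma> x)) / 2))"
    using assms(2) unfolding character_pair_form_def star_def by auto
  show ?thesis
    unfolding sine_subtraction_solution_def f g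
    by (auto simp: hom mult per field_simps)
qed

lemma sine_addition_form_solves:
  assumes "sine_addition_form \<sigma> f g chi \<phi> c2"
  shows "sine_subtraction_solution \<sigma> f g"
proof -
  have add: "\<phi> (x * y) = \<phi> x * chi y + \<phi> y * chi x" for x y
    using assms unfolding sine_addition_form_def by blast
  have "star \<sigma> chi = chi" and "star \<sigma> \<phi> = (\<lambda>x. - \<phi> x)"
    using assms unfolding sine_addition_form_def by blast+
  then have s: "chi (\<sigma> x) = chi x" "\<phi> (\<sigma> x) = - \<phi> x" for x
    by (simp_all add: star_def fun_eq_iff)
  have f: "f = \<phi>" and g: "g = (\<lambda>x. chi x + c2 * \<phi> x)"
    using assms unfolding sine_addition_form_def by blast+
  show ?thesis
    unfolding sine_subtraction_solution_def f g by (auto simp: add s algebra_simps)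
qed

lemma multiple_solution_null_on_products:
  assumes "semigroup_automorphism \<sigma>" and "sine_subtraction_solution \<sigma> f g"
    and "f \<noteq> (\<lambda>_. 0)" and "g = (\<lambda>x. \<alpha> * f x)"
  shows "null_on_products_form f g \<alpha>"
proof -
  have "f (x * y) = 0" for x y
  proof -
    obtain z where "y = \<sigma> z"
      using assms(1) unfolding semigroup_automorphism_def by (metis bij_pointE)
    then show ?thesis using assms(2,4) unfolding sine_subtraction_solution_def by simp
  qed
  then show ?thesis using assms(3,4) unfolding null_on_products_form_def products_def by auto
qed

text \<open>The addition laws of \<open>f\<close> and \<open>h\<close> make \<open>h + d f\<close> multiplicative for each square
  root \<open>d\<close> of \<open>k\<close>, and \<open>\<sigma>\<close> replaces \<open>d\<close> by \<open>- d\<close>. Whether \<open>k\<close> vanishes decides between the two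
  families.\<close>

lemma addition_laws_imp_forms:
  fixes f g h :: "'a::semigroup_mult \<Rightarrow> complex"
  assumes f0: "f \<noteq> (\<lambda>_. 0)" and ng: "\<And>\<alpha>. g \<noteq> (\<lambda>x. \<alpha> * f x)"
    and fm: "\<And>x y. f (x * y) = f x * h y + f y * h x"
    and hm: "\<And>x y. h (x * y) = h x * h y + k * f x * f y"
    and fs: "\<And>x. f (\<sigma> x) = - f x" and hs: "\<And>x. h (\<sigma> x) = h x"
    and g: "\<And>x. g x = h x - l * f x"
  shows "(\<exists>chi c c1. character_pair_form \<sigma> f g chi c c1)
       \<or> (\<exists>chi \<phi> c2. sine_addition_form \<sigma> f g chi \<phi> c2)"
proof (cases "k = 0")
  case True
  have "h \<noteq> (\<lambda>_. 0)"
  proof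
    assume "h = (\<lambda>_. 0)"
    then have "g = (\<lambda>x. (- l) * f x)" by (simp add: g fun_eq_iff)
    then show False using ng by blast
  qed
  then have "sine_addition_form \<sigma> f g h f (- l)"
    using True unfolding sine_addition_form_def multiplicative_fun_def star_def
    by (auto simp: fun_eq_iff hm fm fs hs g)
  then show ?thesis by blast
next
  case False
  define d where "d = csqrt k"
  have d0: "d \<noteq> 0" and k: "k = d * d"
    using False power2_csqrt[of k] by (auto simp: d_def power2_eq_square)
  define chi where "chi x = h x + d * f x" for x
  have star: "star \<sigma> chi = (\<lambda>x. h x - d * f x)"
    by (auto simp: star_def chi_def fs hs)
  have "multiplicative_fun chi"
    unfolding multiplicative_fun_def by (auto simp: chi_def fm hm k algebra_simps)
  moreover have "chi \<noteq> star \<sigma> chi"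
    using f0 d0 unfolding star by (auto simp: chi_def fun_eq_iff)
  moreover have "chi \<circ> (\<sigma> \<circ> \<sigma>) = chi" by (auto simp: chi_def fs hs)
  moreover have "f = (\<lambda>x. 1 / (2 * d) * (chi x - star \<sigma> chi x))"
    using d0 unfolding star by (auto simp: chi_def fun_eq_iff)
  moreover have "g = (\<lambda>x. (chi x + star \<sigma> chi x) / 2 + (- l / d) * ((chi x - star \<sigma> chi x) / 2))"
    using d0 unfolding star by (auto simp: chi_def fun_eq_iff g)
  ultimately have "character_pair_form \<sigma> f g chi (1 / (2 * d)) (- l / d)"
    using d0 unfolding character_pair_form_def by auto
  then show ?thesis by blast
qed

text \<open>Products enter the addition laws through expressions symmetric in the two factors, which
  gives centrality; applied to \<open>x * (y * z)\<close>, the laws contain \<open>y\<close> and \<open>z\<close> only through the values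
  of \<open>f\<close> and \<open>h\<close> at \<open>y * z\<close>.\<close>

lemma addition_laws_imp_abelian:
  fixes f g h :: "'a::semigroup_mult \<Rightarrow> complex"
  assumes fm: "\<And>x y. f (x * y) = f x * h y + f y * h x"
    and hm: "\<And>x y. h (x * y) = h x * h y + k * f x * f y"
    and g: "\<And>x. g x = h x - l * f x"
  shows "abelian_fun f" and "abelian_fun g"
  unfolding abelian_fun_def central_fun_def g by (auto simp: fm hm algebra_simps)

lemma null_on_products_form_abelian:
  assumes "null_on_products_form f g \<alpha>"
  shows "abelian_fun f" and "abelian_fun g"
proof -
  have "f (x * y) = 0" for x y
    using assms unfolding null_on_products_form_def products_def by blast
  then show "abelian_fun f" "abelian_fun g"
    using assms unfolding null_on_products_form_def abelian_fun_def central_fun_def by auto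
qed

lemma nonzero_solution_classified_and_abelian:
  assumes aut: "semigroup_automorphism \<sigma>" and sol: "sine_subtraction_solution \<sigma> f g"
    and f0: "f \<noteq> (\<lambda>_. 0)"
  shows "((\<exists>\<alpha>. null_on_products_form f g \<alpha>)
          \<or> (\<exists>chi c c1. character_pair_form \<sigma> f g chi c c1)
          \<or> (\<exists>chi \<phi> c2. sine_addition_form \<sigma> f g chi \<phi> c2))
        \<and> abelian_fun f \<and> abelian_fun g"
proof (cases "\<exists>\<alpha>. g = (\<lambda>x. \<alpha> * f x)")
  case True
  then show ?thesis
    using multiple_solution_null_on_products[OF aut sol f0] null_on_products_form_abelian by blast
next
  case False
  then have ng: "g \<noteq> (\<lambda>x. \<alpha> * f x)" for \<alpha> by blast
  have eq: "f (x * \<sigma> y) = f x * g y - f y * g x" for x y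
    using sol unfolding sine_subtraction_solution_def by blast
  obtain h k l where laws: "\<And>x y. f (x * y) = f x * h y + f y * h x"
    "\<And>x y. h (x * y) = h x * h y + k * f x * f y"
    and sig: "\<And>x. f (\<sigma> x) = - f x" "\<And>x. h (\<sigma> x) = h x"
    and g: "\<And>x. g x = h x - l * f x"
    using independent_solution_addition_laws[OF aut eq f0 ng] by blast
  show ?thesis
    using addition_laws_imp_forms[OF f0 ng laws sig g] addition_laws_imp_abelian[OF laws g] by blast
qed

section \<open>Continuity\<close>

lemma continuous_right_translation:
  assumes "topological_semigroup T"
  shows "continuous_map T T (\<lambda>x. x * s)"
proof -
  have "continuous_map T (prod_topology T T) (\<lambda>x. (x, s))"
    using assms by (auto simp: topological_semigroup_def continuous_map_pairedI)
  moreover have "continuous_map (prod_topology T T) T (\<lambda>(x, y). x * y)"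
    using assms by (simp add: topological_semigroup_def)
  ultimately have "continuous_map T T ((\<lambda>(x, y). x * y) \<circ> (\<lambda>x. (x, s)))"
    by (rule continuous_map_compose)
  then show ?thesis by (simp add: o_def)
qed

lemma continuous_functions_linear_combination:
  assumes "f \<in> continuous_functions T" and "g \<in> continuous_functions T"
  shows "(\<lambda>x. a * f x + b * g x) \<in> continuous_functions T"
proof -
  have "continuous_map T euclidean (\<lambda>x. a * f x)" "continuous_map T euclidean (\<lambda>x. b * g x)"
    using assms unfolding continuous_functions_def
    by (auto intro!: tendsto_mult simp: continuous_map_atin)
  then show ?thesis
    unfolding continuous_functions_def by (simp add: continuous_map_add)
qed

lemma solution_second_function_continuous:
  assumes sol: "sine_subtraction_solution \<sigma> f g" and f0: "f \<noteq> (\<lambda>_. 0)"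
    and T: "topological_semigroup T" and f: "f \<in> continuous_functions T"
  shows "g \<in> continuous_functions T"
proof -
  obtain y where y: "f y \<noteq> 0" using f0 by auto
  have "continuous_map T euclidean (f \<circ> (\<lambda>x. x * \<sigma> y))"
    using continuous_right_translation[OF T] f unfolding continuous_functions_def
    by (auto intro: continuous_map_compose)
  then have "(\<lambda>x. f (x * \<sigma> y)) \<in> continuous_functions T"
    by (simp add: continuous_functions_def o_def)
  then have "(\<lambda>x. g y / f y * f x + (- 1 / f y) * f (x * \<sigma> y)) \<in> continuous_functions T"
    using f by (rule continuous_functions_linear_combination[rotated])
  moreover have "g = (\<lambda>x. g y / f y * f x + (- 1 / f y) * f (x * \<sigma> y))"
    using sol y unfolding sine_subtraction_solution_def by (auto simp: field_simps)
  ultimately show ?thesis by simp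
qed

lemma character_pair_form_continuous:
  assumes form: "character_pair_form \<sigma> f g chi c c1"
    and f: "f \<in> continuous_functions T" and g: "g \<in> continuous_functions T"
  shows "chi \<in> continuous_functions T" and "star \<sigma> chi \<in> continuous_functions T"
proof -
  have c: "c \<noteq> 0" and eqs: "\<And>x. f x = c * (chi x - star \<sigma> chi x)"
    "\<And>x. g x = (chi x + star \<sigma> chi x) / 2 + c1 * ((chi x - star \<sigma> chi x) / 2)"
    using form unfolding character_pair_form_def by auto
  have "chi = (\<lambda>x. ((1 - c1) / (2 * c)) * f x + 1 * g x)"
    "star \<sigma> chi = (\<lambda>x. ((- 1 - c1) / (2 * c)) * f x + 1 * g x)"
    using c by (auto simp: eqs field_simps fun_eq_iff)
  then show "chi \<in> continuous_functions T" "star \<sigma> chi \<in> continuous_functions T"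
    using continuous_functions_linear_combination[OF f g] by metis+
qed

lemma sine_addition_form_continuous:
  assumes form: "sine_addition_form \<sigma> f g chi \<phi> c2"
    and f: "f \<in> continuous_functions T" and g: "g \<in> continuous_functions T"
  shows "chi \<in> continuous_functions T" and "star \<sigma> chi \<in> continuous_functions T"
    and "\<phi> \<in> continuous_functions T"
proof -
  have "chi = (\<lambda>x. (- c2) * f x + 1 * g x)"
    using form unfolding sine_addition_form_def by auto
  then show chi: "chi \<in> continuous_functions T"
    using continuous_functions_linear_combination[OF f g] by metis
  show "star \<sigma> chi \<in> continuous_functions T" "\<phi> \<in> continuous_functions T"
    using form chi f unfolding sine_addition_form_def by auto
qed

section \<open>The solutions of the sine subtraction law\<close>

theorem theorem5p2:
  fixes \<sigma> :: "'a::semigroup_mult \<Rightarrow> 'a"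
    and f g :: "'a \<Rightarrow> complex"
  assumes "semigroup_automorphism \<sigma>"
  shows "(sine_subtraction_solution \<sigma> f g \<longleftrightarrow>
            f = (\<lambda>_. 0)
          \<or> (\<exists>\<alpha>. null_on_products_form f g \<alpha>)
          \<or> (\<exists>chi c c1. character_pair_form \<sigma> f g chi c c1)
          \<or> (\<exists>chi \<phi> c2. sine_addition_form \<sigma> f g chi \<phi> c2))
    \<and> (sine_subtraction_solution \<sigma> f g \<and> f \<noteq> (\<lambda>_. 0) \<longrightarrow> abelian_fun f \<and> abelian_fun g)
    \<and> (\<forall>T. sine_subtraction_solution \<sigma> f g \<and> f \<noteq> (\<lambda>_. 0)
            \<and> topological_semigroup T \<and> f \<in> continuous_functions T \<longrightarrow>
          g \<in> continuous_functions T
        \<and> (\<forall>chi c c1. character_pair_form \<sigma> f g chi c c1 \<longrightarrow>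
              chi \<in> continuous_functions T \<and> star \<sigma> chi \<in> continuous_functions T)
        \<and> (\<forall>chi \<phi> c2. sine_addition_form \<sigma> f g chi \<phi> c2 \<longrightarrow>
              chi \<in> continuous_functions T \<and> star \<sigma> chi \<in> continuous_functions T
              \<and> \<phi> \<in> continuous_functions T))"
proof (intro conjI)
  let ?forms = "(\<exists>\<alpha>. null_on_products_form f g \<alpha>)
          \<or> (\<exists>chi c c1. character_pair_form \<sigma> f g chi c c1)
          \<or> (\<exists>chi \<phi> c2. sine_addition_form \<sigma> f g chi \<phi> c2)"
  have zero: "sine_subtraction_solution \<sigma> f g" if "f = (\<lambda>_. 0)"
    using that by (simp add: sine_subtraction_solution_def)
  show "sine_subtraction_solution \<sigma> f g \<longleftrightarrow> f = (\<lambda>_. 0) \<or> ?forms"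
    using zero nonzero_solution_classified_and_abelian[OF assms, of f g]
      null_on_products_form_solves[of f g _ \<sigma>] character_pair_form_solves[OF assms, of f g]
      sine_addition_form_solves[of \<sigma> f g] by blast
  show "sine_subtraction_solution \<sigma> f g \<and> f \<noteq> (\<lambda>_. 0) \<longrightarrow> abelian_fun f \<and> abelian_fun g"
    using nonzero_solution_classified_and_abelian[OF assms, of f g] by blast
next
  show "\<forall>T. sine_subtraction_solution \<sigma> f g \<and> f \<noteq> (\<lambda>_. 0)
            \<and> topological_semigroup T \<and> f \<in> continuous_functions T \<longrightarrow>
          g \<in> continuous_functions T
        \<and> (\<forall>chi c c1. character_pair_form \<sigma> f g chi c c1 \<longrightarrow>
              chi \<in> continuous_functions T \<and> star \<sigma> chi \<in> continuous_functions T)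
        \<and> (\<forall>chi \<phi> c2. sine_addition_form \<sigma> f g chi \<phi> c2 \<longrightarrow>
              chi \<in> continuous_functions T \<and> star \<sigma> chi \<in> continuous_functions T
              \<and> \<phi> \<in> continuous_functions T)"
  proof (intro allI impI, elim conjE)
    fix T :: "'a topology"
    assume "sine_subtraction_solution \<sigma> f g" "f \<noteq> (\<lambda>_. 0)" "topological_semigroup T"
      and f: "f \<in> continuous_functions T"
    then have g: "g \<in> continuous_functions T" by (rule solution_second_function_continuous)
    show "g \<in> continuous_functions T
        \<and> (\<forall>chi c c1. character_pair_form \<sigma> f g chi c c1 \<longrightarrow>
              chi \<in> continuous_functions T \<and> star \<sigma> chi \<in> continuous_functions T)
        \<and> (\<forall>chi \<phi> c2. sine_addition_form \<sigma> f g chi \<phi> c2 \<longrightarrow>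
              chi \<in> continuous_functions T \<and> star \<sigma> chi \<in> continuous_functions T
              \<and> \<phi> \<in> continuous_functions T)"
      using g character_pair_form_continuous[OF _ f g] sine_addition_form_continuous[OF _ f g]
      by blast
  qed
qed

end
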